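(* Let $X$ be a separable Banach space. Then $X$ fails the Infinite Tree Property if and only if $DT(X)<\omega_1$.
   Context: All Banach spaces are real; $B_X$ is the closed unit ball. $\omega=\{0,1,2,\dots\}$, $\omega_1$ is the first uncountable ordinal. For every limit ordinal $\alpha<\omega_1$ fix once and for all an enumeration $(\beta_n)_{n\in\omega}$ of all ordinals less than $\alpha$. For finite sequences $s,t$, $s\cdot t$ denotes their concatenation ($s$ followed by $t$); a single element $a$ is identified with the one-term sequence consisting of $a$, and $a\cdot T=\{a\cdot t:t\in T\}$ for a set $T$ of finite sequences. Sets $T_\alpha$ ($\alpha<\omega_1$) of finite sequences in $\omega$ are defined by: $T_0=\{\varnothing\}$; $T_{\alpha+1}=\{\varnothing\}\cup 0\cdot T_\alpha\cup 1\cdot T_\alpha$; for $\alpha$ limit, $T_\alpha=\{\varnothing\}\cup\bigcup_{n\in\omega} n\cdot T_{\beta_n}$. Every $s\in T_\alpha$ has in $T_\alpha$ either no successor, exactly the two successors $s\cdot 0,s\cdot 1$, or the successors $s\cdot n$ for all $n\in\omega$. For $\delta>0$, a $\delta$-$\alpha$-tree in $X$ is a family $(x_s)_{s\in T_\alpha}\subset X$ such that: if $s$ has exactly two successors then $x_s=\frac12(x_{s\cdot 0}+x_{s\cdot 1})$ and $\|x_{s\cdot 0}-x_s\|=\|x_{s\cdot 1}-x_s\|=\frac12\|x_{s\cdot 0}-x_{s\cdot 1}\|\ge\delta$; if $s$ has infinitely many successors then $x_s=x_{s\cdot n}$ for all $n\in\omega$. For $\delta>0$, $DT(X,\delta)=\inf\{\alpha<\omega_1: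 B_X \text{ does not contain a } \delta\text{-}\alpha\text{-tree}\}$ if this set is nonempty, and $DT(X,\delta)=\infty$ otherwise (with $\alpha<\infty$ for all ordinals $\alpha$); $DT(X)=\sup_{\delta>0}DT(X,\delta)$. $X$ has the Infinite Tree Property if there exist $\delta>0$ and $f:\{0,1\}^{<\omega}\to B_X$ (defined on all finite $0$-$1$ sequences) such that for all $s$, $f(s)=\frac12(f(s\cdot 0)+f(s\cdot 1))$ and $\frac12\|f(s\cdot 0)-f(s\cdot 1)\|\ge\delta$. *)

theory Defs
  imports "HOL-Analysis.Analysis" "HOL-Library.Countable_Set_Type"
begin

section \<open>The countable ordinals\<close>

text \<open>The cardinal successor of \<open>natLeq\<close> is a well-order of type \<open>\<omega>\<^sub>1\<close>; its points serve as
  the ordinals below \<open>\<omega>\<^sub>1\<close>. The order type is pinned down by \<open>countable_lessThan_cord\<close> and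
  \<open>uncountable_UNIV_cord\<close> below.\<close>

typedef cord = "Field (cardSuc natLeq)"
  using Field_cardSuc_not_empty[OF natLeq_Card_order] by blast

lemma well_order_cardSuc_natLeq:
  "well_order_on (Field (cardSuc natLeq)) (cardSuc natLeq)"
  using cardSuc_Well_order[OF natLeq_Card_order] .

instantiation cord :: wellorder
begin

definition less_eq_cord :: "cord \<Rightarrow> cord \<Rightarrow> bool"
  where "\<alpha> \<le> \<beta> \<longleftrightarrow> (Rep_cord \<alpha>, Rep_cord \<beta>) \<in> cardSuc natLeq"

definition less_cord :: "cord \<Rightarrow> cord \<Rightarrow> bool"
  where "(\<alpha>::cord) < \<beta> \<longleftrightarrow> \<alpha> \<le> \<beta> \<and> \<alpha> \<noteq> \<beta>"

instance
proof
  let ?r = "cardSuc natLeq"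
  have refl: "refl_on (Field ?r) ?r" and tr: "trans ?r" and anti: "antisym ?r"
    and tot: "total_on (Field ?r) ?r" and wf: "wf (?r - Id)"
    using well_order_cardSuc_natLeq unfolding order_on_defs by auto
  fix x y z :: cord
  show le_refl: "x \<le> x"
    using refl Rep_cord unfolding less_eq_cord_def refl_on_def by blast
  show "x \<le> y \<Longrightarrow> y \<le> z \<Longrightarrow> x \<le> z"
    using tr unfolding less_eq_cord_def trans_def by blast
  show le_anti: "x \<le> y \<Longrightarrow> y \<le> x \<Longrightarrow> x = y"
    using anti unfolding less_eq_cord_def antisym_def by (metis Rep_cord_inject)
  show "x \<le> y \<or> y \<le> x"
  proof (cases "x = y")
    case True
    then show ?thesis using le_refl by simp
  next
    case False
    then have "Rep_cord x \<noteq> Rep_cord y" by (simp add: Rep_cord_inject)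
    then show ?thesis
      using tot Rep_cord[of x] Rep_cord[of y] unfolding less_eq_cord_def total_on_def by blast
  qed
  show "x < y \<longleftrightarrow> x \<le> y \<and> \<not> y \<le> x"
    using le_anti le_refl unfolding less_cord_def by blast
next
  let ?r = "cardSuc natLeq"
  fix P :: "cord \<Rightarrow> bool" and a
  assume step: "\<And>x. (\<And>y. y < x \<Longrightarrow> P y) \<Longrightarrow> P x"
  have "wf (?r - Id)"
    using well_order_cardSuc_natLeq unfolding order_on_defs by auto
  then have wf: "wf (inv_image (?r - Id) Rep_cord)" by (rule wf_inv_image)
  show "P a"
    using wf
  proof (induction a rule: wf_induct_rule)
    case (less x)
    show ?case
    proof (rule step)
      fix y assume "y < x"
      then have "(y, x) \<in> inv_image (?r - Id) Rep_cord"
        by (simp add: less_cord_def less_eq_cord_def Rep_cord_inject)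
      then show "P y" by (rule less)
    qed
  qed
qed

end

lemma countable_lessThan_cord:
  includes cardinal_syntax
  shows "countable {..<\<alpha>::cord}"
proof -
  let ?U = "underS (cardSuc natLeq) (Rep_cord \<alpha>)"
  have "|?U| <o cardSuc natLeq"
    by (rule card_of_underS[OF cardSuc_Card_order[OF natLeq_Card_order] Rep_cord])
  then have "|?U| \<le>o natLeq"
    using cardSuc_ordLeq_ordLess[OF natLeq_Card_order card_of_Card_order] by blast
  then have "countable ?U" by (simp add: countable_card_le_natLeq)
  moreover have "Rep_cord ` {..<\<alpha>} \<subseteq> ?U"
    by (auto simp: underS_def less_cord_def less_eq_cord_def Rep_cord_inject)
  ultimately have "countable (Rep_cord ` {..<\<alpha>})" by (rule countable_subset[rotated])
  then show ?thesis
    by (rule countable_image_inj_on) (auto simp: inj_on_def Rep_cord_inject)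
qed

lemma uncountable_UNIV_cord:
  includes cardinal_syntax
  shows "uncountable (UNIV :: cord set)"
proof
  assume "countable (UNIV :: cord set)"
  then have "countable (Rep_cord ` UNIV)" by (rule countable_image)
  then have "countable (Field (cardSuc natLeq))"
    using type_definition.Rep_range[OF type_definition_cord] by simp
  then have "|Field (cardSuc natLeq)| \<le>o natLeq" by (simp add: countable_card_le_natLeq)
  then have "cardSuc natLeq \<le>o natLeq"
    using card_of_Field_ordIso[OF cardSuc_Card_order[OF natLeq_Card_order]]
      ordIso_ordLeq_trans ordIso_symmetric by blast
  then show False
    using cardSuc_greater[OF natLeq_Card_order] not_ordLess_ordLeq by blast
qed

lemma ex_greater_cord: "\<exists>\<beta>. (\<alpha>::cord) < \<beta>"
proof (rule ccontr)
  assume "\<not> ?thesis"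
  then have "UNIV = insert \<alpha> {..<\<alpha>}" by (auto simp: not_less_iff_gr_or_eq)
  then show False
    using uncountable_UNIV_cord countable_lessThan_cord by (metis countable_insert)
qed

definition ozero :: cord
  where "ozero = (LEAST \<alpha>. True)"

definition osucc :: "cord \<Rightarrow> cord"
  where "osucc \<alpha> = (LEAST \<beta>. \<alpha> < \<beta>)"

definition limit_ord :: "cord \<Rightarrow> bool"
  where "limit_ord \<alpha> \<longleftrightarrow> \<alpha> \<noteq> ozero \<and> (\<forall>\<beta>. \<alpha> \<noteq> osucc \<beta>)"

lemma ozero_le: "ozero \<le> \<alpha>"
  unfolding ozero_def by (rule Least_le) simp

lemma less_osucc: "\<alpha> < osucc \<alpha>"
  unfolding osucc_def using ex_greater_cord by (rule LeastI_ex)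

lemma osucc_le: "\<alpha> < \<beta> \<Longrightarrow> osucc \<alpha> \<le> \<beta>"
  unfolding osucc_def by (rule Least_le)

lemma osucc_inject: "osucc \<alpha> = osucc \<beta> \<longleftrightarrow> \<alpha> = \<beta>"
  using less_osucc osucc_le by (metis leD neqE)

lemma osucc_neq_ozero: "osucc \<alpha> \<noteq> ozero"
  using less_osucc ozero_le by (metis leD)


section \<open>Values of the index\<close>

text \<open>The values that suprema of countable ordinals and of \<open>\<infinity>\<close> can take: a countable ordinal,
  \<open>\<omega>\<^sub>1\<close> (the supremum of an unbounded set of countable ordinals), or \<open>\<infinity>\<close>, which exceeds all
  ordinals.\<close>

datatype xord = Ctbl cord | Omega1 | Infty

instantiation xord :: linorder
begin

fun less_eq_xord :: "xord \<Rightarrow> xord \<Rightarrow> bool" where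
  "Ctbl \<alpha> \<le> Ctbl \<beta> \<longleftrightarrow> \<alpha> \<le> \<beta>"
| "Ctbl \<alpha> \<le> Omega1 \<longleftrightarrow> True"
| "Omega1 \<le> Ctbl \<beta> \<longleftrightarrow> False"
| "Omega1 \<le> Omega1 \<longleftrightarrow> True"
| "Infty \<le> Ctbl \<beta> \<longleftrightarrow> False"
| "Infty \<le> Omega1 \<longleftrightarrow> False"
| "(x::xord) \<le> Infty \<longleftrightarrow> True"

definition less_xord :: "xord \<Rightarrow> xord \<Rightarrow> bool"
  where "(x::xord) < y \<longleftrightarrow> x \<le> y \<and> \<not> y \<le> x"

instance
proof
  fix x y z :: xord
  show "x < y \<longleftrightarrow> x \<le> y \<and> \<not> y \<le> x" by (rule less_xord_def)
  show "x \<le> x" by (cases x) auto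
  show "x \<le> y \<Longrightarrow> y \<le> z \<Longrightarrow> x \<le> z" by (cases x; cases y; cases z) auto
  show "x \<le> y \<Longrightarrow> y \<le> x \<Longrightarrow> x = y" by (cases x; cases y) auto
  show "x \<le> y \<or> y \<le> x" by (cases x; cases y) auto
qed

end

instance xord :: wellorder
proof
  fix P :: "xord \<Rightarrow> bool" and a
  assume step: "\<And>x. (\<And>y. y < x \<Longrightarrow> P y) \<Longrightarrow> P x"
  have ctbl: "P (Ctbl \<alpha>)" for \<alpha>
  proof (induction \<alpha> rule: less_induct)
    case (less \<alpha>)
    show ?case
    proof (rule step)
      fix y assume "y < Ctbl \<alpha>"
      then show "P y" using less by (cases y) (auto simp: less_xord_def)
    qed
  qed
  have om: "P Omega1"
  proof (rule step)
    fix y assume "y < Omega1"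
    then show "P y" using ctbl by (cases y) (auto simp: less_xord_def)
  qed
  show "P a"
  proof (rule step)
    fix y assume "y < a"
    then have "y \<noteq> Infty" by (cases a) (auto simp: less_xord_def)
    then show "P y" using ctbl om by (cases y) auto
  qed
qed

instantiation xord :: complete_linorder
begin

definition bot_xord :: xord where "bot_xord = Ctbl ozero"
definition top_xord :: xord where "top_xord = Infty"
definition inf_xord :: "xord \<Rightarrow> xord \<Rightarrow> xord" where "inf_xord = min"
definition sup_xord :: "xord \<Rightarrow> xord \<Rightarrow> xord" where "sup_xord = max"
definition Inf_xord :: "xord set \<Rightarrow> xord"
  where "Inf_xord A = (if A = {} then Infty else LEAST x. x \<in> A)"
definition Sup_xord :: "xord set \<Rightarrow> xord"
  where "Sup_xord A = (LEAST u. \<forall>a\<in>A. a \<le> u)"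

instance
proof
  fix x y z :: xord and A :: "xord set"
  have le_Infty: "u \<le> Infty" for u by (cases u) auto
  have bot_le: "Ctbl ozero \<le> u" for u by (cases u) (auto simp: ozero_le)
  show "inf x y \<le> x" "inf x y \<le> y" "x \<le> sup x y" "y \<le> sup x y"
    by (simp_all add: inf_xord_def sup_xord_def)
  show "x \<le> y \<Longrightarrow> x \<le> z \<Longrightarrow> x \<le> inf y z" by (simp add: inf_xord_def)
  show "y \<le> x \<Longrightarrow> z \<le> x \<Longrightarrow> sup y z \<le> x" by (simp add: sup_xord_def)
  show "x \<in> A \<Longrightarrow> Inf A \<le> x" by (auto simp: Inf_xord_def intro: Least_le)
  show "(\<And>x. x \<in> A \<Longrightarrow> z \<le> x) \<Longrightarrow> z \<le> Inf A"
  proof (cases "A = {}")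
    case False
    then have "(LEAST x. x \<in> A) \<in> A" by (metis LeastI ex_in_conv)
    then show "(\<And>x. x \<in> A \<Longrightarrow> z \<le> x) \<Longrightarrow> z \<le> Inf A"
      using False by (simp add: Inf_xord_def)
  qed (simp add: Inf_xord_def le_Infty)
  have "\<forall>a\<in>A. a \<le> Sup A"
    unfolding Sup_xord_def by (rule LeastI[of _ Infty]) (simp add: le_Infty)
  then show "x \<in> A \<Longrightarrow> x \<le> Sup A" by blast
  show "(\<And>x. x \<in> A \<Longrightarrow> x \<le> z) \<Longrightarrow> Sup A \<le> z"
    unfolding Sup_xord_def by (rule Least_le) blast
  show "Inf {} = (top::xord)" by (simp add: Inf_xord_def top_xord_def)
  show "Sup {} = (bot::xord)"
    unfolding Sup_xord_def bot_xord_def by (rule Least_equality) (simp_all add: bot_le)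
qed

end


section \<open>The index trees\<close>

text \<open>An enumeration, for each limit ordinal, of the ordinals below it. It is a parameter of all
  notions that follow.\<close>

definition limit_enumeration :: "(cord \<Rightarrow> nat \<Rightarrow> cord) \<Rightarrow> bool"
  where "limit_enumeration \<beta> \<longleftrightarrow> (\<forall>\<alpha>. limit_ord \<alpha> \<longrightarrow> range (\<beta> \<alpha>) = {..<\<alpha>})"

text \<open>The recursion over \<open>\<alpha>\<close> is written inductively; the defining equations are \<open>tree_zero\<close>,
  \<open>tree_succ\<close> and \<open>tree_limit\<close>.\<close>

inductive in_tree :: "(cord \<Rightarrow> nat \<Rightarrow> cord) \<Rightarrow> cord \<Rightarrow> nat list \<Rightarrow> bool"
  for \<beta> :: "cord \<Rightarrow> nat \<Rightarrow> cord"
where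
  root: "in_tree \<beta> \<alpha> []"
| succ: "in_tree \<beta> \<alpha> s \<Longrightarrow> i \<in> {0, 1} \<Longrightarrow> in_tree \<beta> (osucc \<alpha>) (i # s)"
| limit: "limit_ord \<alpha> \<Longrightarrow> in_tree \<beta> (\<beta> \<alpha> n) s \<Longrightarrow> in_tree \<beta> \<alpha> (n # s)"

definition tree :: "(cord \<Rightarrow> nat \<Rightarrow> cord) \<Rightarrow> cord \<Rightarrow> nat list set"
  where "tree \<beta> \<alpha> = {s. in_tree \<beta> \<alpha> s}"

lemma tree_zero: "tree \<beta> ozero = {[]}"
  unfolding tree_def
  by (auto intro: in_tree.intros elim: in_tree.cases simp: limit_ord_def osucc_neq_ozero[symmetric])

lemma tree_succ: "tree \<beta> (osucc \<alpha>) = {[]} \<union> (#) 0 ` tree \<beta> \<alpha> \<union> (#) 1 ` tree \<beta> \<alpha>"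
proof -
  have "s \<in> {[]} \<union> (#) 0 ` tree \<beta> \<alpha> \<union> (#) 1 ` tree \<beta> \<alpha>" if "in_tree \<beta> (osucc \<alpha>) s" for s
    using that by cases (auto simp: tree_def osucc_inject limit_ord_def)
  then show ?thesis by (auto simp: tree_def intro: in_tree.intros)
qed

lemma tree_limit: "limit_ord \<alpha> \<Longrightarrow> tree \<beta> \<alpha> = {[]} \<union> (\<Union>n. (#) n ` tree \<beta> (\<beta> \<alpha> n))"
proof -
  assume lim: "limit_ord \<alpha>"
  have "s \<in> {[]} \<union> (\<Union>n. (#) n ` tree \<beta> (\<beta> \<alpha> n))" if "in_tree \<beta> \<alpha> s" for s
    using that by cases (use lim in \<open>auto simp: tree_def limit_ord_def\<close>)
  then show ?thesis using lim by (auto simp: tree_def intro: in_tree.intros)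
qed

definition successors :: "nat list set \<Rightarrow> nat list \<Rightarrow> nat list set"
  where "successors S s = {t \<in> S. \<exists>n. t = s @ [n]}"

lemma successors_Cons:
  "successors ({[]} \<union> (\<Union>i\<in>I. (#) i ` S i)) (i # s) = (if i \<in> I then (#) i ` successors (S i) s else {})"
  by (auto simp: successors_def image_iff)

lemma successors_Nil:
  assumes "\<And>i. i \<in> I \<Longrightarrow> [] \<in> S i"
  shows "successors ({[]} \<union> (\<Union>i\<in>I. (#) i ` S i)) [] = (\<lambda>i. [i]) ` I"
  using assms by (auto simp: successors_def image_iff)

lemma successors_tree_cases:
  "in_tree \<beta> \<alpha> s \<Longrightarrow> successors (tree \<beta> \<alpha>) s \<in> {{}, {s @ [0], s @ [1]}, range (\<lambda>n. s @ [n])}"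
proof (induction rule: in_tree.induct)
  case (root \<alpha>)
  have Nil: "[] \<in> tree \<beta> \<gamma>" for \<gamma> by (simp add: tree_def in_tree.root)
  consider "\<alpha> = ozero" | \<gamma> where "\<alpha> = osucc \<gamma>" | "limit_ord \<alpha>"
    unfolding limit_ord_def by blast
  then show ?case
  proof cases
    case 1
    then show ?thesis by (simp add: tree_zero successors_def)
  next
    case 2
    then have "tree \<beta> \<alpha> = {[]} \<union> (\<Union>i\<in>{0,1}. (#) i ` tree \<beta> \<gamma>)" by (auto simp: tree_succ)
    then show ?thesis using successors_Nil[where I = "{0,1}" and S = "\<lambda>_. tree \<beta> \<gamma>"] Nil by simp
  next
    case 3
    then show ?thesis using successors_Nil[where I = "UNIV" and S = "\<lambda>n. tree \<beta> (\<beta> \<alpha> n)"] Nil by (simp add: tree_limit)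
  qed
next
  case (succ \<alpha> s i)
  have "tree \<beta> (osucc \<alpha>) = {[]} \<union> (\<Union>i\<in>{0,1}. (#) i ` tree \<beta> \<alpha>)" by (auto simp: tree_succ)
  then have "successors (tree \<beta> (osucc \<alpha>)) (i # s) = (#) i ` successors (tree \<beta> \<alpha>) s"
    using successors_Cons[where I = "{0,1}" and S = "\<lambda>_. tree \<beta> \<alpha>"] succ by simp
  then show ?case using succ by (auto simp: image_image)
next
  case (limit \<alpha> n s)
  then have "successors (tree \<beta> \<alpha>) (n # s) = (#) n ` successors (tree \<beta> (\<beta> \<alpha> n)) s"
    using successors_Cons[where I = "UNIV" and S = "\<lambda>n. tree \<beta> (\<beta> \<alpha> n)"] by (simp add: tree_limit)
  then show ?case using limit by (auto simp: image_image)
qed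


section \<open>Dyadic trees in Banach spaces\<close>

text \<open>A family indexed by \<open>tree \<beta> \<alpha>\<close> is a function on all lists whose values off \<open>tree \<beta> \<alpha>\<close> are
  irrelevant. By \<open>successors_tree_cases\<close>, two successors are always \<open>s @ [0]\<close> and \<open>s @ [1]\<close>.\<close>

definition delta_tree ::
  "(cord \<Rightarrow> nat \<Rightarrow> cord) \<Rightarrow> real \<Rightarrow> cord \<Rightarrow> (nat list \<Rightarrow> 'a::real_normed_vector) \<Rightarrow> bool"
  where "delta_tree \<beta> \<delta> \<alpha> x \<longleftrightarrow>
    (\<forall>s\<in>tree \<beta> \<alpha>.
      (card (successors (tree \<beta> \<alpha>) s) = 2 \<longrightarrow>
        x s = (1/2) *\<^sub>R (x (s @ [0]) + x (s @ [1])) \<and>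
        norm (x (s @ [0]) - x s) = norm (x (s @ [1]) - x s) \<and>
        norm (x (s @ [1]) - x s) = (1/2) * norm (x (s @ [0]) - x (s @ [1])) \<and>
        (1/2) * norm (x (s @ [0]) - x (s @ [1])) \<ge> \<delta>) \<and>
      (infinite (successors (tree \<beta> \<alpha>) s) \<longrightarrow> (\<forall>n. x s = x (s @ [n]))))"

definition ball_contains_delta_tree ::
  "'a::real_normed_vector itself \<Rightarrow> (cord \<Rightarrow> nat \<Rightarrow> cord) \<Rightarrow> real \<Rightarrow> cord \<Rightarrow> bool"
  where "ball_contains_delta_tree X \<beta> \<delta> \<alpha> \<longleftrightarrow>
    (\<exists>x :: nat list \<Rightarrow> 'a. delta_tree \<beta> \<delta> \<alpha> x \<and> (\<forall>s\<in>tree \<beta> \<alpha>. x s \<in> cball 0 1))"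

text \<open>In \<open>xord\<close> the infimum of the empty set is \<open>Infty\<close>.\<close>

definition DT_delta ::
  "'a::real_normed_vector itself \<Rightarrow> (cord \<Rightarrow> nat \<Rightarrow> cord) \<Rightarrow> real \<Rightarrow> xord"
  where "DT_delta X \<beta> \<delta> = (INF \<alpha>\<in>{\<alpha>. \<not> ball_contains_delta_tree X \<beta> \<delta> \<alpha>}. Ctbl \<alpha>)"

definition DT :: "'a::real_normed_vector itself \<Rightarrow> (cord \<Rightarrow> nat \<Rightarrow> cord) \<Rightarrow> xord"
  where "DT X \<beta> = (SUP \<delta>\<in>{0<..}. DT_delta X \<beta> \<delta>)"

definition infinite_tree_property :: "'a::real_normed_vector itself \<Rightarrow> bool"
  where "infinite_tree_property X \<longleftrightarrow>
    (\<exists>\<delta>>0. \<exists>f :: nat list \<Rightarrow> 'a. \<forall>s\<in>lists {0, 1}.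
      f s \<in> cball 0 1 \<and>
      f s = (1/2) *\<^sub>R (f (s @ [0]) + f (s @ [1])) \<and>
      (1/2) * norm (f (s @ [0]) - f (s @ [1])) \<ge> \<delta>)"

end

theory Submission
  imports Defs
begin

text \<open>
  For fixed \<open>\<delta>\<close>, collect the values at the root of all \<open>\<delta>\<close>-\<open>\<alpha>\<close>-trees in the unit ball into a set
  \<open>tree_roots \<beta> \<delta> \<alpha>\<close>. These sets form a derivation: a successor step keeps the midpoints of
  \<open>2\<delta>\<close>-separated pairs (\<open>tree_roots_osucc\<close>), a limit step is an intersection
  (\<open>tree_roots_limit\<close>), and the sets decrease with \<open>\<alpha>\<close> (\<open>tree_roots_antimono\<close>).

  An infinite tree survives every step, because each of its points is the midpoint of a separated
  pair of its points; so the Infinite Tree Property makes some \<open>DT(X, \<delta>)\<close> infinite.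

  For the converse, suppose that no \<open>tree_roots \<beta> \<delta> \<alpha>\<close> with
  \<open>\<alpha> < \<omega>\<^sub>1\<close> is empty. There is no evident point common to all of
  these sets, but separability provides an approximate one: call \<open>q\<close> persistent at
  scale \<open>e\<close> if every \<open>tree_roots \<beta> \<delta> \<alpha>\<close> has a point
  within \<open>e\<close> of \<open>q\<close>. With candidates taken from a countable dense set, a
  pigeonhole argument over the uncountably many \<open>\<alpha>\<close> shows that persistent
  points exist at all scales, and that each persistent point is nearly the midpoint of a separated
  pair of points that are persistent at half the scale (\<open>persistent_split\<close>).
  Iterating gives a separated dyadic tree whose midpoint equations hold up to errors that decrease
  geometrically with the level. Replacing each value by the limit of the averages over the levels
  below it turns this into an exact infinite tree, whose separation is still at least
  \<open>\<delta>/2\<close> if the errors are small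
  (\<open>exact_tree_of_approximate_tree\<close>).

  So, if \<open>X\<close> fails the Infinite Tree Property, every \<open>DT(X, \<delta>)\<close> is a countable ordinal. Since
  \<open>DT(X, \<delta>)\<close> grows as \<open>\<delta>\<close> decreases, the supremum may be taken over \<open>\<delta> = 1/(n+1)\<close>, and a
  countable set of countable ordinals is bounded below \<open>\<omega>\<^sub>1\<close>.
\<close>

section \<open>Countable ordinals\<close>

lemma countable_cord_bounded:
  assumes "countable (A :: cord set)"
  shows "\<exists>\<alpha>. \<forall>a\<in>A. a < \<alpha>"
proof (rule ccontr)
  assume "\<not> ?thesis"
  then have "UNIV = (\<Union>a\<in>A. insert a {..<a})"
    by (force simp: not_less le_less)
  moreover have "countable (\<Union>a\<in>A. insert a {..<a})"
    using assms countable_lessThan_cord by (intro countable_UN) auto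
  ultimately show False using uncountable_UNIV_cord by simp
qed

text \<open>If each of countably many decreasing properties failed somewhere, they would all fail at a
  common bound of the places of failure.\<close>

lemma cord_pigeonhole:
  fixes P :: "'i \<Rightarrow> cord \<Rightarrow> bool"
  assumes "countable I" and ex: "\<And>\<alpha>. \<exists>i\<in>I. P i \<alpha>"
    and anti: "\<And>i \<alpha> \<gamma>. P i \<alpha> \<Longrightarrow> \<gamma> \<le> \<alpha> \<Longrightarrow> P i \<gamma>"
  shows "\<exists>i\<in>I. \<forall>\<alpha>. P i \<alpha>"
proof (rule ccontr)
  assume "\<not> ?thesis"
  then obtain a where a: "\<And>i. i \<in> I \<Longrightarrow> \<not> P i (a i)" by metis
  have "countable (a ` I)" using assms(1) by simp
  from countable_cord_bounded[OF this] obtain \<alpha> where "\<And>i. i \<in> I \<Longrightarrow> a i < \<alpha>" by auto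
  then show False using ex[of \<alpha>] anti a by (metis less_imp_le)
qed

lemma cord_cases [case_names zero succ limit]:
  obtains "\<alpha> = ozero" | \<gamma> where "\<alpha> = osucc \<gamma>" | "limit_ord \<alpha>"
  unfolding limit_ord_def by blast

lemma less_osucc_iff: "\<gamma> < osucc \<alpha> \<longleftrightarrow> \<gamma> \<le> \<alpha>"
  using less_osucc osucc_le by (metis leD le_less_trans not_le)

lemma limit_ord_osucc_less: "limit_ord \<alpha> \<Longrightarrow> \<gamma> < \<alpha> \<Longrightarrow> osucc \<gamma> < \<alpha>"
  using osucc_le[of \<gamma> \<alpha>] unfolding limit_ord_def le_less by blast

section \<open>The derivation given by the roots of trees\<close>

definition tree_roots ::
  "(cord \<Rightarrow> nat \<Rightarrow> cord) \<Rightarrow> real \<Rightarrow> cord \<Rightarrow> 'a::real_normed_vector set"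
  where "tree_roots \<beta> \<delta> \<alpha> = {x [] |x. delta_tree \<beta> \<delta> \<alpha> x \<and> (\<forall>s\<in>tree \<beta> \<alpha>. x s \<in> cball 0 1)}"

lemma ball_contains_delta_tree_iff:
  "ball_contains_delta_tree TYPE('a::real_normed_vector) \<beta> \<delta> \<alpha>
    \<longleftrightarrow> tree_roots \<beta> \<delta> \<alpha> \<noteq> ({} :: 'a set)"
  by (auto simp: ball_contains_delta_tree_def tree_roots_def)

lemma Nil_in_tree: "[] \<in> tree \<beta> \<alpha>"
  by (simp add: tree_def in_tree.root)

lemma tree_roots_subset_cball: "tree_roots \<beta> \<delta> \<alpha> \<subseteq> cball 0 1"
  using Nil_in_tree by (auto simp: tree_roots_def)

lemma tree_roots_ozero: "tree_roots \<beta> \<delta> ozero = cball 0 1"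
proof -
  have no_succ: "successors {[]} [] = {}" by (auto simp: successors_def)
  have "y \<in> tree_roots \<beta> \<delta> ozero" if "y \<in> cball 0 1" for y :: 'a
    unfolding tree_roots_def delta_tree_def mem_Collect_eq
    using that by (intro exI[of _ "\<lambda>_. y"]) (simp add: tree_zero no_succ)
  then show ?thesis using tree_roots_subset_cball by blast
qed

lemma midpoint_norms:
  fixes y z :: "'a::real_normed_vector"
  assumes "x = (1/2) *\<^sub>R (y + z)"
  shows "norm (y - x) = (1/2) * norm (y - z)" and "norm (z - x) = (1/2) * norm (y - z)"
proof -
  have "y - x = (1/2) *\<^sub>R (y - z)" "z - x = (1/2) *\<^sub>R (z - y)"
    using scaleR_half_double[of y] scaleR_half_double[of z]
    unfolding assms by (simp_all add: algebra_simps)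
  then show "norm (y - x) = (1/2) * norm (y - z)" "norm (z - x) = (1/2) * norm (y - z)"
    by (simp_all add: norm_minus_commute)
qed

definition branching_condition ::
  "real \<Rightarrow> nat list set \<Rightarrow> (nat list \<Rightarrow> 'a::real_normed_vector) \<Rightarrow> nat list \<Rightarrow> bool"
  where "branching_condition \<delta> A x s \<longleftrightarrow>
    (card A = 2 \<longrightarrow> x s = (1/2) *\<^sub>R (x (s @ [0]) + x (s @ [1])) \<and>
      (1/2) * norm (x (s @ [0]) - x (s @ [1])) \<ge> \<delta>) \<and>
    (infinite A \<longrightarrow> (\<forall>n. x s = x (s @ [n])))"

text \<open>The equalities of norms at a binary node follow from the midpoint equation.\<close>

lemma delta_tree_iff:
  "delta_tree \<beta> \<delta> \<alpha> x \<longleftrightarrow>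
    (\<forall>s\<in>tree \<beta> \<alpha>. branching_condition \<delta> (successors (tree \<beta> \<alpha>) s) x s)"
proof -
  have "a = (1/2) *\<^sub>R (b + c) \<and> norm (b - a) = norm (c - a) \<and>
      norm (c - a) = (1/2) * norm (b - c) \<and> \<delta> \<le> (1/2) * norm (b - c) \<longleftrightarrow>
    a = (1/2) *\<^sub>R (b + c) \<and> \<delta> \<le> (1/2) * norm (b - c)" for a b c :: 'a
    using midpoint_norms[of a b c] by argo
  then show ?thesis unfolding delta_tree_def branching_condition_def by presburger
qed

lemma tree_roots_antimono_delta:
  assumes "\<epsilon> \<le> \<delta>" shows "tree_roots \<beta> \<delta> \<alpha> \<subseteq> tree_roots \<beta> \<epsilon> \<alpha>"
proof -
  have "branching_condition \<epsilon> A x s" if "branching_condition \<delta> A x s"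
    for A s and x :: "nat list \<Rightarrow> 'a"
    using that assms unfolding branching_condition_def by (blast intro: order_trans)
  then show ?thesis unfolding tree_roots_def delta_tree_iff by blast
qed

lemma branching_condition_Cons:
  "branching_condition \<delta> ((#) i ` A) x (i # s) \<longleftrightarrow> branching_condition \<delta> A (\<lambda>t. x (i # t)) s"
  by (simp add: branching_condition_def card_image finite_image_iff)

lemma delta_tree_osucc:
  "delta_tree \<beta> \<delta> (osucc \<alpha>) x \<longleftrightarrow>
    x [] = (1/2) *\<^sub>R (x [0] + x [1]) \<and> (1/2) * norm (x [0] - x [1]) \<ge> \<delta> \<and>
    delta_tree \<beta> \<delta> \<alpha> (\<lambda>s. x (0 # s)) \<and> delta_tree \<beta> \<delta> \<alpha> (\<lambda>s. x (1 # s))"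
proof -
  have eq: "tree \<beta> (osucc \<alpha>) = {[]} \<union> (\<Union>i\<in>{0,1}. (#) i ` tree \<beta> \<alpha>)" by (auto simp: tree_succ)
  have succ: "successors (tree \<beta> (osucc \<alpha>)) (i # s) = (#) i ` successors (tree \<beta> \<alpha>) s"
    if "i \<in> {0, 1}" for i s
    unfolding eq using that by (subst successors_Cons) simp
  have nil: "successors (tree \<beta> (osucc \<alpha>)) [] = {[0], [1]}"
    unfolding eq by (subst successors_Nil) (auto simp: Nil_in_tree)
  have split: "(\<forall>s\<in>tree \<beta> (osucc \<alpha>). P s) \<longleftrightarrow>
    P [] \<and> (\<forall>s\<in>tree \<beta> \<alpha>. P (0 # s)) \<and> (\<forall>s\<in>tree \<beta> \<alpha>. P (1 # s))" for P
    unfolding tree_succ by blast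
  show ?thesis
    unfolding delta_tree_iff split nil
    by (simp add: succ branching_condition_Cons) (simp add: branching_condition_def)
qed

lemma delta_tree_limit:
  assumes "limit_ord \<alpha>"
  shows "delta_tree \<beta> \<delta> \<alpha> x \<longleftrightarrow>
    (\<forall>n. x [n] = x [] \<and> delta_tree \<beta> \<delta> (\<beta> \<alpha> n) (\<lambda>s. x (n # s)))"
proof -
  note eq = tree_limit[OF assms, of \<beta>]
  have succ: "successors (tree \<beta> \<alpha>) (n # s) = (#) n ` successors (tree \<beta> (\<beta> \<alpha> n)) s" for n s
    unfolding eq by (subst successors_Cons) simp
  have nil: "successors (tree \<beta> \<alpha>) [] = range (\<lambda>n. [n])"
    unfolding eq by (subst successors_Nil) (auto simp: Nil_in_tree)
  have infin: "infinite (range (\<lambda>n::nat. [n]))"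
    by (rule range_inj_infinite) (simp add: inj_on_def)
  have split: "(\<forall>s\<in>tree \<beta> \<alpha>. P s) \<longleftrightarrow> P [] \<and> (\<forall>n. \<forall>s\<in>tree \<beta> (\<beta> \<alpha> n). P (n # s))" for P
    unfolding eq by blast
  show ?thesis
    unfolding delta_tree_iff split nil succ branching_condition_Cons
    using infin by (auto simp: branching_condition_def)
qed

lemma tree_roots_osucc:
  "tree_roots \<beta> \<delta> (osucc \<alpha>) =
    {(1/2) *\<^sub>R (y + z) |y z. y \<in> tree_roots \<beta> \<delta> \<alpha> \<and> z \<in> tree_roots \<beta> \<delta> \<alpha> \<and>
      (1/2) * norm (y - z) \<ge> \<delta>}" (is "_ = ?R")
proof (intro set_eqI iffI)
  fix p :: 'a
  assume "p \<in> tree_roots \<beta> \<delta> (osucc \<alpha>)"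
  then obtain x where x: "p = x []" "delta_tree \<beta> \<delta> (osucc \<alpha>) x"
    and ball: "\<forall>s\<in>tree \<beta> (osucc \<alpha>). x s \<in> cball 0 1"
    unfolding tree_roots_def by blast
  have "x [i] \<in> tree_roots \<beta> \<delta> \<alpha>" if "i \<in> {0, 1}" for i
    unfolding tree_roots_def mem_Collect_eq using that x ball
    by (intro exI[of _ "\<lambda>s. x (i # s)"]) (auto simp: delta_tree_osucc tree_succ)
  then show "p \<in> ?R" using x by (auto simp: delta_tree_osucc)
next
  fix p :: 'a
  assume "p \<in> ?R"
  then obtain y z :: "nat list \<Rightarrow> 'a" where p: "p = (1/2) *\<^sub>R (y [] + z [])"
    and sep: "(1/2) * norm (y [] - z []) \<ge> \<delta>"
    and y: "delta_tree \<beta> \<delta> \<alpha> y" "\<forall>s\<in>tree \<beta> \<alpha>. y s \<in> cball 0 1"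
    and z: "delta_tree \<beta> \<delta> \<alpha> z" "\<forall>s\<in>tree \<beta> \<alpha>. z s \<in> cball 0 1"
    unfolding tree_roots_def by blast
  have "norm (y [] + z []) \<le> 2"
    using norm_triangle_ineq[of "y []" "z []"] y(2) z(2) Nil_in_tree[of \<beta> \<alpha>] by fastforce
  then have "norm p \<le> 1" unfolding p by simp
  define x where "x s = (case s of [] \<Rightarrow> p | i # t \<Rightarrow> if i = 0 then y t else z t)" for s :: "nat list"
  have "delta_tree \<beta> \<delta> (osucc \<alpha>) x"
    using p sep y(1) z(1) by (simp add: delta_tree_osucc x_def)
  moreover have "\<forall>s\<in>tree \<beta> (osucc \<alpha>). x s \<in> cball 0 1"
    using y(2) z(2) \<open>norm p \<le> 1\<close> by (auto simp: tree_succ x_def)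
  moreover have "p = x []" by (simp add: x_def)
  ultimately show "p \<in> tree_roots \<beta> \<delta> (osucc \<alpha>)" unfolding tree_roots_def by blast
qed

lemma tree_roots_limit:
  assumes "limit_ord \<alpha>"
  shows "tree_roots \<beta> \<delta> \<alpha> = (\<Inter>n. tree_roots \<beta> \<delta> (\<beta> \<alpha> n))"
proof (intro set_eqI iffI)
  fix p :: 'a
  assume "p \<in> tree_roots \<beta> \<delta> \<alpha>"
  then obtain x where x: "p = x []" "delta_tree \<beta> \<delta> \<alpha> x" "\<forall>s\<in>tree \<beta> \<alpha>. x s \<in> cball 0 1"
    unfolding tree_roots_def by blast
  have "p \<in> tree_roots \<beta> \<delta> (\<beta> \<alpha> n)" for n
    unfolding tree_roots_def mem_Collect_eq using x assms
    by (intro exI[of _ "\<lambda>s. x (n # s)"]) (auto simp: delta_tree_limit tree_limit)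
  then show "p \<in> (\<Inter>n. tree_roots \<beta> \<delta> (\<beta> \<alpha> n))" by blast
next
  fix p :: 'a
  assume p: "p \<in> (\<Inter>n. tree_roots \<beta> \<delta> (\<beta> \<alpha> n))"
  then have "\<forall>n. \<exists>x. p = x [] \<and> delta_tree \<beta> \<delta> (\<beta> \<alpha> n) x \<and>
      (\<forall>s\<in>tree \<beta> (\<beta> \<alpha> n). x s \<in> cball 0 1)"
    unfolding tree_roots_def by blast
  then obtain y where y: "\<And>n. p = y n []" "\<And>n. delta_tree \<beta> \<delta> (\<beta> \<alpha> n) (y n)"
      "\<And>n s. s \<in> tree \<beta> (\<beta> \<alpha> n) \<Longrightarrow> y n s \<in> cball 0 1"
    by metis
  have "norm p \<le> 1" using p tree_roots_subset_cball by fastforce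
  define x where "x s = (case s of [] \<Rightarrow> p | n # t \<Rightarrow> y n t)" for s
  have "delta_tree \<beta> \<delta> \<alpha> x"
    using y(1)[symmetric] y(2) by (simp add: delta_tree_limit[OF assms] x_def)
  moreover have "\<forall>s\<in>tree \<beta> \<alpha>. x s \<in> cball 0 1"
    using y(3) \<open>norm p \<le> 1\<close> by (auto simp: tree_limit[OF assms] x_def)
  moreover have "p = x []" by (simp add: x_def)
  ultimately show "p \<in> tree_roots \<beta> \<delta> \<alpha>" unfolding tree_roots_def by blast
qed

text \<open>The successor operation is monotone in the set of available points, so the inclusion of a
  stage in the preceding one propagates from all earlier stages.\<close>

lemma tree_roots_antimono:
  assumes \<beta>: "limit_enumeration \<beta>" and "\<gamma> \<le> \<alpha>"
  shows "tree_roots \<beta> \<delta> \<alpha> \<subseteq> (tree_roots \<beta> \<delta> \<gamma> :: 'a::real_normed_vector set)"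
proof -
  let ?D = "tree_roots \<beta> \<delta> :: cord \<Rightarrow> 'a set"
  have lim: "range (\<beta> \<alpha>) = {..<\<alpha>}" if "limit_ord \<alpha>" for \<alpha>
    using \<beta> that unfolding limit_enumeration_def by blast
  have mono: "?D (osucc \<alpha>) \<subseteq> ?D (osucc \<gamma>)" if "?D \<alpha> \<subseteq> ?D \<gamma>" for \<alpha> \<gamma>
    unfolding tree_roots_osucc using that by blast
  have "\<forall>\<gamma><\<alpha>. ?D \<alpha> \<subseteq> ?D \<gamma>" for \<alpha>
  proof (induction \<alpha> rule: less_induct)
    case (less \<alpha>)
    show ?case
    proof (cases \<alpha> rule: cord_cases)
      case zero
      then show ?thesis using ozero_le leD by blast
    next
      case limit
      have "?D \<alpha> \<subseteq> ?D \<gamma>" if "\<gamma> < \<alpha>" for \<gamma>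
      proof -
        obtain n where "\<gamma> = \<beta> \<alpha> n" using lim[OF limit] \<open>\<gamma> < \<alpha>\<close> by blast
        then show ?thesis using tree_roots_limit[OF limit] by blast
      qed
      then show ?thesis by blast
    next
      case (succ \<alpha>')
      have IH: "?D \<alpha>' \<subseteq> ?D \<gamma>" if "\<gamma> < \<alpha>'" for \<gamma>
        using less that less_osucc succ by blast
      have "?D (osucc \<alpha>') \<subseteq> ?D \<alpha>'"
      proof (cases \<alpha>' rule: cord_cases)
        case zero
        then show ?thesis using tree_roots_ozero tree_roots_subset_cball by metis
      next
        case (succ \<alpha>'')
        then show ?thesis using mono IH less_osucc by blast
      next
        case limit
        have "?D (osucc \<alpha>') \<subseteq> ?D (\<beta> \<alpha>' n)" for n
        proof -
          have "\<beta> \<alpha>' n < \<alpha>'" using lim[OF limit] by blast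
          then have "?D (osucc \<alpha>') \<subseteq> ?D (osucc (\<beta> \<alpha>' n))" using mono IH by blast
          also have "\<dots> \<subseteq> ?D (\<beta> \<alpha>' n)"
            using less limit_ord_osucc_less[OF limit \<open>\<beta> \<alpha>' n < \<alpha>'\<close>] less_osucc succ
            by (meson less_trans)
          finally show ?thesis .
        qed
        then show ?thesis using tree_roots_limit[OF limit] by blast
      qed
      then show ?thesis using IH unfolding succ less_osucc_iff le_less by blast
    qed
  qed
  then show ?thesis using \<open>\<gamma> \<le> \<alpha>\<close> unfolding le_less by blast
qed

section \<open>Infinite trees survive the derivation\<close>

lemma infinite_tree_in_tree_roots:
  fixes f :: "nat list \<Rightarrow> 'a::real_normed_vector"
  assumes \<beta>: "limit_enumeration \<beta>"
    and f: "\<forall>s\<in>lists {0, 1}. f s \<in> cball 0 1 \<and> f s = (1/2) *\<^sub>R (f (s @ [0]) + f (s @ [1])) \<and>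
      (1/2) * norm (f (s @ [0]) - f (s @ [1])) \<ge> \<delta>"
    and "s \<in> lists {0, 1}"
  shows "f s \<in> tree_roots \<beta> \<delta> \<alpha>"
  using assms(3)
proof (induction \<alpha> arbitrary: s rule: less_induct)
  case (less \<alpha>)
  note fs = f[rule_format, OF less.prems]
  show ?case
  proof (cases \<alpha> rule: cord_cases)
    case zero
    then show ?thesis using fs tree_roots_ozero by blast
  next
    case (succ \<gamma>)
    have "f (s @ [0]) \<in> tree_roots \<beta> \<delta> \<gamma>" "f (s @ [1]) \<in> tree_roots \<beta> \<delta> \<gamma>"
      using less less_osucc succ by auto
    then show ?thesis unfolding succ tree_roots_osucc using fs by blast
  next
    case limit
    then have "\<beta> \<alpha> n < \<alpha>" for n using \<beta> unfolding limit_enumeration_def by blast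
    then show ?thesis unfolding tree_roots_limit[OF limit] using less by blast
  qed
qed

section \<open>From approximate to exact infinite trees\<close>

lemma geometric_increments_limit:
  fixes u :: "nat \<Rightarrow> 'a::banach"
  assumes u: "\<And>n. norm (u (Suc n) - u n) \<le> C * (1/2) ^ n"
  obtains l where "u \<longlonglongrightarrow> l" "norm (l - u 0) \<le> 2 * C"
proof -
  have geo: "(\<lambda>n. C * (1/2) ^ n) sums (C * 2)"
    using sums_mult[OF geometric_sums[of "1/2 :: real"], of C] by simp
  have sm: "summable (\<lambda>n. norm (u (Suc n) - u n))"
    by (rule summable_comparison_test[OF _ sums_summable[OF geo]]) (use u in simp)
  then have "(\<lambda>n. \<Sum>k<n. u (Suc k) - u k) \<longlonglongrightarrow> (\<Sum>k. u (Suc k) - u k)"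
    by (intro summable_LIMSEQ) (rule summable_norm_cancel)
  then have "(\<lambda>n. u n - u 0) \<longlonglongrightarrow> (\<Sum>k. u (Suc k) - u k)"
    by (simp add: sum_lessThan_telescope)
  then have "u \<longlonglongrightarrow> (\<Sum>k. u (Suc k) - u k) + u 0"
    using tendsto_add[OF _ tendsto_const[of "u 0"]] by fastforce
  moreover have "norm (\<Sum>k. u (Suc k) - u k) \<le> 2 * C"
    using summable_norm[OF sm] suminf_le[OF u sm sums_summable[OF geo]] sums_unique[OF geo]
    by simp
  ultimately show thesis using that[of "(\<Sum>k. u (Suc k) - u k) + u 0"] by simp
qed

primrec level_average :: "(nat list \<Rightarrow> 'a::real_vector) \<Rightarrow> nat \<Rightarrow> nat list \<Rightarrow> 'a"
  where
    "level_average g 0 s = g s"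
  | "level_average g (Suc n) s =
      (1/2) *\<^sub>R (level_average g n (s @ [0]) + level_average g n (s @ [1]))"

lemma norm_half_add_le:
  fixes a b :: "'a::real_normed_vector"
  assumes "norm a \<le> r" "norm b \<le> r"
  shows "norm ((1/2) *\<^sub>R (a + b)) \<le> r"
  using norm_triangle_ineq[of a b] assms by simp

text \<open>Passing from one level of averages to the next costs at most the midpoint error of that
  level, so the averages converge; their limits satisfy the midpoint equations exactly and stay
  within \<open>2C\<close> of the given values.\<close>

lemma exact_tree_of_approximate_tree:
  fixes g :: "nat list \<Rightarrow> 'a::banach"
  assumes mid: "\<And>s. norm ((1/2) *\<^sub>R (g (s @ [0]) + g (s @ [1])) - g s) \<le> C * (1/2) ^ length s"
    and ball: "\<And>s. norm (g s) \<le> 1 + E * (1/2) ^ length s"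
  obtains f where "\<And>s. f s = (1/2) *\<^sub>R (f (s @ [0]) + f (s @ [1]))"
    "\<And>s. norm (f s - g s) \<le> 2 * C" "\<And>s. norm (f s) \<le> 1"
proof -
  let ?A = "level_average g"
  have "0 \<le> C" using mid[of "[]"] order_trans[OF norm_ge_zero] by fastforce
  have incr: "norm (?A (Suc n) s - ?A n s) \<le> C * (1/2) ^ (length s + n)" for n s
  proof (induction n arbitrary: s)
    case 0
    then show ?case using mid by simp
  next
    case (Suc n)
    have "?A (Suc (Suc n)) s - ?A (Suc n) s = (1/2) *\<^sub>R
        ((?A (Suc n) (s @ [0]) - ?A n (s @ [0])) + (?A (Suc n) (s @ [1]) - ?A n (s @ [1])))"
      unfolding level_average.simps(2)[of g "Suc n" s] level_average.simps(2)[of g n s]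
      by (simp only: scaleR_diff_right[symmetric] add_diff_add)
    then show ?case
      using norm_half_add_le[OF Suc[of "s @ [0]"]] Suc[of "s @ [1]"] by simp
  qed
  have bound: "norm (?A n s) \<le> 1 + E * (1/2) ^ (length s + n)" for n s
  proof (induction n arbitrary: s)
    case 0
    then show ?case using ball by simp
  next
    case (Suc n)
    then show ?case
      using norm_half_add_le[OF Suc[of "s @ [0]"]] Suc[of "s @ [1]"] by simp
  qed
  have "\<exists>l. (\<lambda>n. ?A n s) \<longlonglongrightarrow> l \<and> norm (l - g s) \<le> 2 * C" for s
  proof -
    have "norm (?A (Suc n) s - ?A n s) \<le> C * (1/2) ^ n" for n
    proof -
      have "(1/2 :: real) ^ (length s + n) \<le> (1/2) ^ n" by (rule power_decreasing) auto
      then show ?thesis using incr[of n s] \<open>0 \<le> C\<close> by (meson mult_left_mono order_trans)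
    qed
    then show ?thesis
      using geometric_increments_limit[of "\<lambda>n. ?A n s" C] by (metis level_average.simps(1))
  qed
  then obtain f where lim: "\<And>s. (\<lambda>n. ?A n s) \<longlonglongrightarrow> f s"
    and near: "\<And>s. norm (f s - g s) \<le> 2 * C"
    by metis
  have "f s = (1/2) *\<^sub>R (f (s @ [0]) + f (s @ [1]))" for s
  proof (rule LIMSEQ_unique)
    show "(\<lambda>n. ?A (Suc n) s) \<longlonglongrightarrow> f s" using lim LIMSEQ_Suc by blast
    show "(\<lambda>n. ?A (Suc n) s) \<longlonglongrightarrow> (1/2) *\<^sub>R (f (s @ [0]) + f (s @ [1]))"
      unfolding level_average.simps by (intro tendsto_intros lim)
  qed
  moreover have "norm (f s) \<le> 1" for s
  proof (rule LIMSEQ_le)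
    show "(\<lambda>n. norm (?A n s)) \<longlonglongrightarrow> norm (f s)" by (intro tendsto_intros lim)
    have "(\<lambda>n. (1/2 :: real) ^ n) \<longlonglongrightarrow> 0" by (rule LIMSEQ_power_zero) simp
    then have "(\<lambda>n. (1/2 :: real) ^ (n + length s)) \<longlonglongrightarrow> 0" by (rule LIMSEQ_ignore_initial_segment)
    then have "(\<lambda>n. 1 + E * (1/2) ^ (n + length s)) \<longlonglongrightarrow> 1 + E * 0"
      by (intro tendsto_intros)
    then show "(\<lambda>n. 1 + E * (1/2) ^ (length s + n)) \<longlonglongrightarrow> 1" by (simp add: add.commute)
  qed (use bound in blast)
  ultimately show thesis using that near by blast
qed

text \<open>Dependent choice along the binary tree. Lists grow at the end along the tree but recursion
  peels them from the front, so the choice is made along reversed lists.\<close>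

lemma dependent_choice_binary_tree:
  fixes q :: 'a
  assumes "P 0 q"
    and step: "\<And>n q. P n q \<Longrightarrow> \<exists>a b. P (Suc n) a \<and> P (Suc n) b \<and> R n q a b"
  obtains g :: "nat list \<Rightarrow> 'a" where "\<And>s. P (length s) (g s)"
    "\<And>s. R (length s) (g s) (g (s @ [0])) (g (s @ [1]))"
proof -
  obtain a b where ab: "\<And>n q. P n q \<Longrightarrow> P (Suc n) (a n q) \<and> P (Suc n) (b n q) \<and> R n q (a n q) (b n q)"
    using step by metis
  define h where "h = rec_list q (\<lambda>i t p. (if i = (0::nat) then a else b) (length t) p)"
  have h: "h [] = q" "\<And>i t. h (i # t) = (if i = 0 then a else b) (length t) (h t)"
    by (simp_all add: h_def)
  have P: "P (length t) (h t)" for t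
    by (induction t) (use ab \<open>P 0 q\<close> in \<open>auto simp: h\<close>)
  show thesis
  proof (rule that[of "\<lambda>s. h (rev s)"])
    fix s :: "nat list"
    show "P (length s) (h (rev s))" using P[of "rev s"] by simp
    then show "R (length s) (h (rev s)) (h (rev (s @ [0]))) (h (rev (s @ [1])))"
      using ab by (simp add: h)
  qed
qed

section \<open>Persistent points\<close>

definition persistent ::
  "(cord \<Rightarrow> nat \<Rightarrow> cord) \<Rightarrow> real \<Rightarrow> real \<Rightarrow> 'a::real_normed_vector \<Rightarrow> bool"
  where "persistent \<beta> \<delta> e q \<longleftrightarrow> (\<forall>\<alpha>. \<exists>x\<in>tree_roots \<beta> \<delta> \<alpha>. norm (x - q) < e)"

lemma separable_space_dense:
  assumes "separable_space (euclidean :: 'a::metric_space topology)"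
  obtains Q :: "'a::metric_space set" where "countable Q" "\<And>x e. 0 < e \<Longrightarrow> \<exists>q\<in>Q. dist x q < e"
proof -
  obtain Q :: "'a set" where "countable Q" "closure Q = UNIV"
    using assms unfolding separable_space_def by auto
  then show thesis using that[of Q] by (metis UNIV_I closure_approachable dist_commute)
qed

lemma persistent_exists:
  assumes \<beta>: "limit_enumeration \<beta>"
    and sep: "separable_space (euclidean :: 'a::real_normed_vector topology)"
    and ne: "\<And>\<alpha>. tree_roots \<beta> \<delta> \<alpha> \<noteq> ({} :: 'a set)" and "0 < e"
  shows "\<exists>q :: 'a. persistent \<beta> \<delta> e q"
proof -
  obtain Q :: "'a set" where Q: "countable Q" "\<And>x e. 0 < e \<Longrightarrow> \<exists>q\<in>Q. dist x q < e"
    using separable_space_dense[OF sep] by blast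
  have "\<exists>q\<in>Q. \<forall>\<alpha>. \<exists>x\<in>tree_roots \<beta> \<delta> \<alpha>. norm (x - q) < e"
  proof (rule cord_pigeonhole[OF Q(1)])
    show "\<exists>q\<in>Q. \<exists>x\<in>tree_roots \<beta> \<delta> \<alpha>. norm (x - q) < e" for \<alpha>
      using ne[of \<alpha>] Q(2)[OF \<open>0 < e\<close>] unfolding dist_norm by blast
  qed (use tree_roots_antimono[OF \<beta>] in blast)
  then show ?thesis unfolding persistent_def by blast
qed

text \<open>The points of each stage \<open>\<alpha> + 1\<close> near \<open>q\<close> are midpoints of pairs from stage \<open>\<alpha>\<close>, and each pair
  is approximated by one of countably many pairs. By the pigeonhole principle one approximating
  pair serves every \<open>\<alpha>\<close>.\<close>

lemma persistent_split:
  fixes q :: "'a::real_normed_vector"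
  assumes \<beta>: "limit_enumeration \<beta>"
    and sep: "separable_space (euclidean :: 'a topology)"
    and q: "persistent \<beta> \<delta> e q" and "0 < d"
  shows "\<exists>a b. persistent \<beta> \<delta> d a \<and> persistent \<beta> \<delta> d b \<and>
    norm ((1/2) *\<^sub>R (a + b) - q) \<le> e + d \<and> \<delta> - d \<le> (1/2) * norm (a - b)"
proof -
  obtain Q :: "'a set" where Q: "countable Q" "\<And>x e. 0 < e \<Longrightarrow> \<exists>q\<in>Q. dist x q < e"
    using separable_space_dense[OF sep] by blast
  let ?good = "\<lambda>p. norm ((1/2) *\<^sub>R (fst p + snd p) - q) \<le> e + d \<and>
    \<delta> - d \<le> (1/2) * norm (fst p - snd p)"
  let ?P = "\<lambda>p \<alpha>. ?good p \<and> (\<exists>y\<in>tree_roots \<beta> \<delta> \<alpha>. norm (y - fst p) < d) \<and>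
    (\<exists>z\<in>tree_roots \<beta> \<delta> \<alpha>. norm (z - snd p) < d)"
  have "\<exists>p\<in>Q \<times> Q. \<forall>\<alpha>. ?P p \<alpha>"
  proof (rule cord_pigeonhole)
    show "countable (Q \<times> Q)" using Q(1) by simp
    show "\<exists>p\<in>Q \<times> Q. ?P p \<alpha>" for \<alpha>
    proof -
      obtain y z where yz: "y \<in> tree_roots \<beta> \<delta> \<alpha>" "z \<in> tree_roots \<beta> \<delta> \<alpha>"
        "(1/2) * norm (y - z) \<ge> \<delta>" "norm ((1/2) *\<^sub>R (y + z) - q) < e"
        using q[unfolded persistent_def, rule_format, of "osucc \<alpha>"]
        unfolding tree_roots_osucc by blast
      obtain a b where ab: "a \<in> Q" "norm (y - a) < d" "b \<in> Q" "norm (z - b) < d"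
        using Q(2)[OF \<open>0 < d\<close>] unfolding dist_norm by metis
      have "norm ((1/2) *\<^sub>R ((a - y) + (b - z))) \<le> d"
        using ab by (intro norm_half_add_le) (auto simp: norm_minus_commute)
      moreover have eq: "(1/2) *\<^sub>R (a + b) - q
          = (1/2) *\<^sub>R ((a - y) + (b - z)) + ((1/2) *\<^sub>R (y + z) - q)"
        by (simp add: algebra_simps)
      ultimately have "norm ((1/2) *\<^sub>R (a + b) - q) \<le> e + d"
        using norm_triangle_ineq[of "(1/2) *\<^sub>R ((a - y) + (b - z))" "(1/2) *\<^sub>R (y + z) - q"] yz(4)
        unfolding eq by linarith
      moreover have "norm (y - z) \<le> norm (y - a) + norm (a - b) + norm (z - b)"
        by norm
      ultimately have "?P (a, b) \<alpha>" using yz ab by auto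
      then show ?thesis using ab by (intro bexI[of _ "(a, b)"]) auto
    qed
  qed (use tree_roots_antimono[OF \<beta>] in blast)
  then show ?thesis unfolding persistent_def by blast
qed

theorem infinite_tree_property_of_tree_roots:
  assumes \<beta>: "limit_enumeration \<beta>"
    and sep: "separable_space (euclidean :: 'a::banach topology)"
    and "0 < \<delta>" and ne: "\<And>\<alpha>. tree_roots \<beta> \<delta> \<alpha> \<noteq> ({} :: 'a set)"
  shows "infinite_tree_property TYPE('a)"
proof -
  \<comment> \<open>Scales \<open>e n\<close> give midpoint errors at most \<open>2 e n\<close>, hence a total displacement of at most \<open>4c\<close>
    at each node; with the loss \<open>c\<close> in \<open>persistent_split\<close> the separation stays above
    \<open>\<delta> - 5c = \<delta>/2\<close>.\<close>
  define c where "c = \<delta> / 10"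
  define e where "e n = c * (1/2) ^ n" for n :: nat
  have "0 < c" using \<open>0 < \<delta>\<close> by (simp add: c_def)
  then have e: "0 < e n" "e n \<le> c" "e (Suc n) \<le> e n" for n
    by (simp_all add: e_def power_le_one)
  obtain q0 :: 'a where "persistent \<beta> \<delta> (e 0) q0"
    using persistent_exists[OF \<beta> sep ne e(1)] by blast
  then obtain g :: "nat list \<Rightarrow> 'a" where g: "\<And>s. persistent \<beta> \<delta> (e (length s)) (g s)"
    and split: "\<And>s. norm ((1/2) *\<^sub>R (g (s @ [0]) + g (s @ [1])) - g s) \<le> e (length s) + e (Suc (length s))
      \<and> \<delta> - e (Suc (length s)) \<le> (1/2) * norm (g (s @ [0]) - g (s @ [1]))"
    using dependent_choice_binary_tree[where P = "\<lambda>n. persistent \<beta> \<delta> (e n)" and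
        R = "\<lambda>n q a b. norm ((1/2) *\<^sub>R (a + b) - q) \<le> e n + e (Suc n) \<and>
          \<delta> - e (Suc n) \<le> (1/2) * norm (a - b)"]
      persistent_split[OF \<beta> sep _ e(1)] by metis
  have mid: "norm ((1/2) *\<^sub>R (g (s @ [0]) + g (s @ [1])) - g s) \<le> (2 * c) * (1/2) ^ length s" for s
  proof -
    have "e (length s) + e (Suc (length s)) \<le> (2 * c) * (1/2) ^ length s"
      using e(3)[of "length s"] by (simp add: e_def)
    then show ?thesis using split[of s] by linarith
  qed
  have ball: "norm (g s) \<le> 1 + c * (1/2) ^ length s" for s
  proof -
    obtain x :: 'a where "norm x \<le> 1" "norm (x - g s) < e (length s)"
      using g[of s] tree_roots_subset_cball[of \<beta> \<delta> ozero] unfolding persistent_def by fastforce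
    then show ?thesis using norm_triangle_ineq2[of "g s" x] by (simp add: e_def norm_minus_commute)
  qed
  obtain f where f: "\<And>s. f s = (1/2) *\<^sub>R (f (s @ [0]) + f (s @ [1]))"
    "\<And>s. norm (f s - g s) \<le> 2 * (2 * c)" "\<And>s. norm (f s) \<le> 1"
    using exact_tree_of_approximate_tree[OF mid ball] by blast
  have sep_f: "\<delta> / 2 \<le> (1/2) * norm (f (s @ [0]) - f (s @ [1]))" for s
  proof -
    have "norm (g (s @ [0]) - g (s @ [1])) \<le>
        norm (f (s @ [0]) - g (s @ [0])) + norm (f (s @ [0]) - f (s @ [1])) + norm (f (s @ [1]) - g (s @ [1]))"
      by norm
    moreover have "\<delta> - c \<le> (1/2) * norm (g (s @ [0]) - g (s @ [1]))"
      using split[of s] e(2)[of "Suc (length s)"] by linarith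
    ultimately show ?thesis
      using f(2)[of "s @ [0]"] f(2)[of "s @ [1]"] by (simp add: c_def)
  qed
  show ?thesis
    unfolding infinite_tree_property_def mem_cball dist_0_norm
    by (intro exI[of _ "\<delta> / 2"] exI[of _ f] conjI ballI half_gt_zero \<open>0 < \<delta>\<close> f(3) f(1) sep_f)
qed

section \<open>The index\<close>

lemma DT_delta_le:
  assumes "tree_roots \<beta> \<delta> \<alpha> = ({} :: 'a::real_normed_vector set)"
  shows "DT_delta TYPE('a) \<beta> \<delta> \<le> Ctbl \<alpha>"
  unfolding DT_delta_def using assms by (intro INF_lower) (simp add: ball_contains_delta_tree_iff)

theorem theorem3p17:
  fixes \<beta> :: "cord \<Rightarrow> nat \<Rightarrow> cord"
  assumes "limit_enumeration \<beta>"
    and "separable_space (euclidean :: 'a::banach topology)"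
  shows "\<not> infinite_tree_property TYPE('a) \<longleftrightarrow> DT TYPE('a) \<beta> < Omega1"
proof
  assume "DT TYPE('a) \<beta> < Omega1"
  show "\<not> infinite_tree_property TYPE('a)"
  proof
    assume "infinite_tree_property TYPE('a)"
    then obtain \<delta> and f :: "nat list \<Rightarrow> 'a" where "0 < \<delta>"
      and f: "\<forall>s\<in>lists {0, 1}. f s \<in> cball 0 1 \<and> f s = (1/2) *\<^sub>R (f (s @ [0]) + f (s @ [1])) \<and>
        (1/2) * norm (f (s @ [0]) - f (s @ [1])) \<ge> \<delta>"
      unfolding infinite_tree_property_def by blast
    have "f [] \<in> tree_roots \<beta> \<delta> \<alpha>" for \<alpha>
      using infinite_tree_in_tree_roots[OF assms(1) f] by simp
    then have none: "{\<alpha>. tree_roots \<beta> \<delta> \<alpha> = ({} :: 'a set)} = {}" by blast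
    have "DT_delta TYPE('a) \<beta> \<delta> = Infty"
      by (simp add: DT_delta_def ball_contains_delta_tree_iff none top_xord_def)
    moreover have "DT_delta TYPE('a) \<beta> \<delta> \<le> DT TYPE('a) \<beta>"
      unfolding DT_def using \<open>0 < \<delta>\<close> by (intro SUP_upper) simp
    ultimately show False
      using \<open>DT TYPE('a) \<beta> < Omega1\<close> by (cases "DT TYPE('a) \<beta>") (auto simp: less_xord_def)
  qed
next
  assume "\<not> infinite_tree_property TYPE('a)"
  then have "\<exists>\<alpha>. tree_roots \<beta> \<delta> \<alpha> = ({} :: 'a set)" if "0 < \<delta>" for \<delta>
    using infinite_tree_property_of_tree_roots[OF assms that] by blast
  then have "\<forall>n. \<exists>\<alpha>. tree_roots \<beta> (1 / real (Suc n)) \<alpha> = ({} :: 'a set)" by simp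
  then obtain a where a: "\<And>n. tree_roots \<beta> (1 / real (Suc n)) (a n) = ({} :: 'a set)" by metis
  obtain \<alpha> where \<alpha>: "\<And>n. a n < \<alpha>" using countable_cord_bounded[of "range a"] by auto
  have "DT_delta TYPE('a) \<beta> \<delta> \<le> Ctbl \<alpha>" if "0 < \<delta>" for \<delta>
  proof -
    obtain n where "1 / real (Suc n) < \<delta>" using \<open>0 < \<delta>\<close> by (rule nat_approx_posE)
    then have "tree_roots \<beta> \<delta> (a n) = ({} :: 'a set)"
      using tree_roots_antimono_delta[of "1 / real (Suc n)" \<delta> \<beta> "a n"] a[of n]
      by (metis less_imp_le subset_empty)
    then have "DT_delta TYPE('a) \<beta> \<delta> \<le> Ctbl (a n)" by (rule DT_delta_le)
    also have "\<dots> \<le> Ctbl \<alpha>" using \<alpha>[of n] by simp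
    finally show ?thesis .
  qed
  then have "DT TYPE('a) \<beta> \<le> Ctbl \<alpha>" unfolding DT_def by (intro SUP_least) simp
  then show "DT TYPE('a) \<beta> < Omega1"
    by (cases "DT TYPE('a) \<beta>") (auto simp: less_xord_def)
qed

end
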